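(* Let $(D,S)$ be a relational system on $A$ satisfying Condition 1 and let $R_1,\dots,R_M\subseteq A$ ($M\ge 2$) satisfy Condition 2 (both conditions are spelled out in the context). Let $x,y\in A$. If $y$ is assigned to $Range_1$ by the conjoint assignment procedure and $xDy$, then $x$ is assigned by the conjoint assignment procedure to a range $Range_2$ with $Range_2\ge Range_1$.
   Context: $A$ is the set of actions (all actions to be classified and all representative actions). $C=\{C_1,\dots,C_M\}$, $M\ge 2$, is a set of ordered classes, $C_M$ being the highest. Condition 1: $D$ and $S$ are binary relations on $A$ such that $D$ is transitive, $S$ is reflexive, and for all $x,y,z\in A$: $xDy\Rightarrow xSy$; ($xSy$ and $yDz$) $\Rightarrow xSz$; ($xDy$ and $ySz$) $\Rightarrow xSz$. ($S$ is also interpreted as "compatible with the order of the classes", i.e. $xSy$ is an argument for putting $x$ in a class at least as high as $y$; this is interpretive and imposes no further formal constraint.) Condition 2: each class $C_k$ is characterized by a nonempty finite set $R_k\subseteq A$ of representative actions such that (a) for $k=1,\dots,M-1$ and every $w\in R_k$ there is $z\in R_{k+1}$ with $zDw$; (b) for $k=1,\dots,M-1$ and every $w\in R_{k+1}$ there is $z\in R_k$ with $wDz$; (c) for all $1\le k<h\le M$ and every $w\in R_h$ there is no $z\in R_k$ with $zSw$. Notation: $xSR_k$ iff there is $z\in R_k$ with $xSz$; $R_kSx$ iff there is $w\in R_k$ with $wSx$. Descending assignment rule: by convention $xSR_0$ holds for all $x$. Let $k$ be the largest element of $\{0,\dots,M\}$ with $xSR_k$. If $k=M$, assign $x$ to $C_M$;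 if $k=0$, assign $x$ to $C_1$; if $0<k<M$, assign $x$ to the range $C_k-C_{k+1}$ (both classes possible). Ascending assignment rule: by convention $R_{M+1}Sx$ holds for all $x$. Let $k$ be the smallest element of $\{1,\dots,M+1\}$ with $R_kSx$. If $k=1$, assign $x$ to $C_1$; if $k=M+1$, assign $x$ to $C_M$; if $1<k<M+1$, assign $x$ to the range $C_{k-1}-C_k$. Assignment to a single class $C_k$ is regarded as assignment to the range $C_k-C_k$. Conjoint assignment rule (procedure): (a) if $x$ is assigned to $C_M$ by the descending rule and to $C_1$ by the ascending rule, the conjoint range is $C_1-C_M$; (b) if $x$ is assigned to the same range $C_h-C_{h+1}$ by both rules, the conjoint range is $C_h-C_{h+1}$; (c) if $x$ is assigned to $C_h-C_{k'}$ by the ascending rule and to $C_{k''}-C_{h'}$ by the descending rule, the conjoint range is $C_{k'}-C_{k''}$ if $k''\ge k'$, and $C_{k''}-C_{k'}$ if $k''<k'$. (Thus in all cases the two limits of the conjoint range are the lower limit of the descending range and the upper limit of the ascending range.) Comparison of ranges: for ranges $C_k-C_{k'}$ (with $k\le k'$) and $C_h-C_{h'}$ (with $h\le h'$), $(C_k-C_{k'})\ge (C_h-C_{h'})$ ("not worse than") iff $k\ge h$ and $k'\ge h'$. *)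

theory Defs
  imports Main
begin

text \<open>
  Relations are predicates on the ambient type and are only ever evaluated on the carrier \<open>A\<close>.
  Classes are represented by their indices \<open>1, \<dots>, M\<close>, and \<open>R k\<close> is the set of representative
  actions of class \<open>k\<close>; the values \<open>R 0\<close> and \<open>R (M + 1)\<close> are irrelevant.
\<close>

definition condition1 :: "'a set \<Rightarrow> ('a \<Rightarrow> 'a \<Rightarrow> bool) \<Rightarrow> ('a \<Rightarrow> 'a \<Rightarrow> bool) \<Rightarrow> bool" where
  "condition1 A D S \<longleftrightarrow>
     transp_on A D \<and> reflp_on A S \<and>
     (\<forall>x\<in>A. \<forall>y\<in>A. D x y \<longrightarrow> S x y) \<and>
     (\<forall>x\<in>A. \<forall>y\<in>A. \<forall>z\<in>A. S x y \<and> D y z \<longrightarrow> S x z) \<and>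
     (\<forall>x\<in>A. \<forall>y\<in>A. \<forall>z\<in>A. D x y \<and> S y z \<longrightarrow> S x z)"

definition condition2 ::
  "'a set \<Rightarrow> ('a \<Rightarrow> 'a \<Rightarrow> bool) \<Rightarrow> ('a \<Rightarrow> 'a \<Rightarrow> bool) \<Rightarrow> nat \<Rightarrow> (nat \<Rightarrow> 'a set) \<Rightarrow> bool" where
  "condition2 A D S M R \<longleftrightarrow>
     (\<forall>k\<in>{1..M}. R k \<noteq> {} \<and> finite (R k) \<and> R k \<subseteq> A) \<and>
     (\<forall>k\<in>{1..<M}. \<forall>w\<in>R k. \<exists>z\<in>R (k + 1). D z w) \<and>
     (\<forall>k\<in>{1..<M}. \<forall>w\<in>R (k + 1). \<exists>z\<in>R k. D w z) \<and>
     (\<forall>k h. 1 \<le> k \<and> k < h \<and> h \<le> M \<longrightarrow> (\<forall>w\<in>R h. \<not> (\<exists>z\<in>R k. S z w)))"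

text \<open>The first disjuncts below are the conventions on \<open>x S R\<^sub>0\<close> and \<open>R\<^bsub>M+1\<^esub> S x\<close>.\<close>

definition act_S_set :: "('a \<Rightarrow> 'a \<Rightarrow> bool) \<Rightarrow> (nat \<Rightarrow> 'a set) \<Rightarrow> 'a \<Rightarrow> nat \<Rightarrow> bool" where
  "act_S_set S R x k \<longleftrightarrow> k = 0 \<or> (\<exists>z\<in>R k. S x z)"

definition set_S_act :: "('a \<Rightarrow> 'a \<Rightarrow> bool) \<Rightarrow> nat \<Rightarrow> (nat \<Rightarrow> 'a set) \<Rightarrow> nat \<Rightarrow> 'a \<Rightarrow> bool" where
  "set_S_act S M R k x \<longleftrightarrow> k = M + 1 \<or> (\<exists>w\<in>R k. S w x)"

text \<open>The pair \<open>(k, k')\<close> stands for the range from class \<open>k\<close> to class \<open>k'\<close>.\<close>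

type_synonym class_range = "nat \<times> nat"

definition descending :: "('a \<Rightarrow> 'a \<Rightarrow> bool) \<Rightarrow> nat \<Rightarrow> (nat \<Rightarrow> 'a set) \<Rightarrow> 'a \<Rightarrow> class_range" where
  "descending S M R x =
     (let k = Max {k \<in> {0..M}. act_S_set S R x k}
      in if k = M then (M, M) else if k = 0 then (1, 1) else (k, k + 1))"

definition ascending :: "('a \<Rightarrow> 'a \<Rightarrow> bool) \<Rightarrow> nat \<Rightarrow> (nat \<Rightarrow> 'a set) \<Rightarrow> 'a \<Rightarrow> class_range" where
  "ascending S M R x =
     (let k = Min {k \<in> {1..M + 1}. set_S_act S M R k x}
      in if k = 1 then (1, 1) else if k = M + 1 then (M, M) else (k - 1, k))"

definition conjoint :: "('a \<Rightarrow> 'a \<Rightarrow> bool) \<Rightarrow> nat \<Rightarrow> (nat \<Rightarrow> 'a set) \<Rightarrow> 'a \<Rightarrow> class_range" where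
  "conjoint S M R x =
     (if descending S M R x = (M, M) \<and> ascending S M R x = (1, 1) then (1, M)
      else if \<exists>h. descending S M R x = (h, h + 1) \<and> ascending S M R x = (h, h + 1)
        then descending S M R x
      else case ascending S M R x of (h, k') \<Rightarrow>
           case descending S M R x of (k'', h') \<Rightarrow>
             if k' \<le> k'' then (k', k'') else (k'', k'))"

definition range_not_worse :: "class_range \<Rightarrow> class_range \<Rightarrow> bool" where
  "range_not_worse r s \<longleftrightarrow> fst r \<ge> fst s \<and> snd r \<ge> snd s"

text \<open>The three cases of the conjoint rule overlap consistently.\<close>

lemma conjoint_limits:
  assumes "M \<ge> 1"
  shows "conjoint S M R x =
    (min (snd (ascending S M R x)) (fst (descending S M R x)),
     max (snd (ascending S M R x)) (fst (descending S M R x)))"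
  using assms by (auto simp: conjoint_def min_def max_def split: prod.splits)

lemma descending_bounds:
  assumes "M \<ge> 1"
  shows "1 \<le> fst (descending S M R x)" "fst (descending S M R x) \<le> M"
proof -
  let ?K = "{k \<in> {0..M}. act_S_set S R x k}"
  have "0 \<in> ?K" by (simp add: act_S_set_def)
  then have "Max ?K \<in> ?K" by (intro Max_in) auto
  then show "1 \<le> fst (descending S M R x)" "fst (descending S M R x) \<le> M"
    using assms by (auto simp: descending_def Let_def)
qed

lemma ascending_bounds:
  assumes "M \<ge> 1"
  shows "1 \<le> snd (ascending S M R x)" "snd (ascending S M R x) \<le> M"
proof -
  let ?K = "{k \<in> {1..M + 1}. set_S_act S M R k x}"
  have "M + 1 \<in> ?K" by (simp add: set_S_act_def)
  then have "Min ?K \<in> ?K" by (intro Min_in) auto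
  then show "1 \<le> snd (ascending S M R x)" "snd (ascending S M R x) \<le> M"
    using assms by (auto simp: ascending_def Let_def)
qed

text \<open>In particular the conjoint rule always yields a genuine range of classes.\<close>

lemma conjoint_is_range:
  assumes "M \<ge> 1"
  shows "1 \<le> fst (conjoint S M R x)" "fst (conjoint S M R x) \<le> snd (conjoint S M R x)"
    "snd (conjoint S M R x) \<le> M"
  using descending_bounds[OF assms] ascending_bounds[OF assms]
  by (auto simp: conjoint_limits[OF assms])

end

theory Submission
  imports Defs
begin

text \<open>
  The limits of the conjoint range are the smaller and the larger of the lower limit of the
  descending range and the upper limit of the ascending range. Both are monotone along \<open>D\<close>:
  from \<open>D x y\<close>, every \<open>R\<^sub>k\<close> with \<open>y S R\<^sub>k\<close> also satisfies \<open>x S R\<^sub>k\<close>, so the descending maximum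
  can only grow, and every \<open>R\<^sub>k\<close> with \<open>R\<^sub>k S x\<close> also satisfies \<open>R\<^sub>k S y\<close>, so the
  ascending minimum for \<open>x\<close> is taken over a smaller set.
\<close>

text \<open>The three cases collapse: only the index 0, which yields class 1, is changed, hence
  \<open>max 1\<close>.\<close>

lemma fst_descending:
  assumes "M \<ge> 1"
  shows "fst (descending S M R x) = max 1 (Max {k \<in> {0..M}. act_S_set S R x k})"
proof -
  let ?K = "{k \<in> {0..M}. act_S_set S R x k}"
  have "0 \<in> ?K" by (simp add: act_S_set_def)
  then have "Max ?K \<in> ?K" by (intro Max_in) auto
  then show ?thesis using assms by (auto simp: descending_def Let_def)
qed

text \<open>Dually, only the conventional index \<open>M + 1\<close> is changed; it is cut down to
  \<open>M\<close>.\<close>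

lemma snd_ascending:
  assumes "M \<ge> 1"
  shows "snd (ascending S M R x) = min M (Min {k \<in> {1..M + 1}. set_S_act S M R k x})"
proof -
  let ?K = "{k \<in> {1..M + 1}. set_S_act S M R k x}"
  have "M + 1 \<in> ?K" by (simp add: set_S_act_def)
  then have "Min ?K \<in> ?K" by (intro Min_in) auto
  then show ?thesis using assms by (auto simp: ascending_def Let_def)
qed

lemma fst_descending_mono:
  assumes "M \<ge> 1"
    and "\<And>k. k \<in> {1..M} \<Longrightarrow> act_S_set S R y k \<Longrightarrow> act_S_set S R x k"
  shows "fst (descending S M R y) \<le> fst (descending S M R x)"
proof -
  have 0: "act_S_set S R z 0" for z by (simp add: act_S_set_def)
  have "act_S_set S R x k" if "k \<le> M" "act_S_set S R y k" for k
    using that assms(2) 0 by (cases "k = 0") auto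
  then have "{k \<in> {0..M}. act_S_set S R y k} \<subseteq> {k \<in> {0..M}. act_S_set S R x k}" by auto
  moreover have "{k \<in> {0..M}. act_S_set S R y k} \<noteq> {}" using 0 by auto
  ultimately have "Max {k \<in> {0..M}. act_S_set S R y k} \<le> Max {k \<in> {0..M}. act_S_set S R x k}"
    by (intro Max_mono) auto
  then show ?thesis unfolding fst_descending[OF assms(1)] by (rule max.mono[OF order_refl])
qed

lemma snd_ascending_mono:
  assumes "M \<ge> 1"
    and "\<And>k. k \<in> {1..M} \<Longrightarrow> set_S_act S M R k x \<Longrightarrow> set_S_act S M R k y"
  shows "snd (ascending S M R y) \<le> snd (ascending S M R x)"
proof -
  have top: "set_S_act S M R (M + 1) z" for z by (simp add: set_S_act_def)
  have "set_S_act S M R k y" if "k \<in> {1..M + 1}" "set_S_act S M R k x" for k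
    using that assms(2) top by (cases "k = M + 1") auto
  then have "{k \<in> {1..M + 1}. set_S_act S M R k x} \<subseteq> {k \<in> {1..M + 1}. set_S_act S M R k y}"
    by auto
  \<comment> \<open>The convention makes the smaller set nonempty, as \<open>Min_antimono\<close>
    requires.\<close>
  moreover have "M + 1 \<in> {k \<in> {1..M + 1}. set_S_act S M R k x}" using top by simp
  ultimately have "Min {k \<in> {1..M + 1}. set_S_act S M R k y} \<le> Min {k \<in> {1..M + 1}. set_S_act S M R k x}"
    by (intro Min_antimono) auto
  then show ?thesis unfolding snd_ascending[OF assms(1)] by (rule min.mono[OF order_refl])
qed

theorem proposition5:
  fixes A :: "'a set" and D S :: "'a \<Rightarrow> 'a \<Rightarrow> bool"
    and M :: nat and R :: "nat \<Rightarrow> 'a set"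
    and x y :: 'a and Range1 :: class_range
  assumes "M \<ge> 2"
    and "condition1 A D S"
    and "condition2 A D S M R"
    and "x \<in> A" and "y \<in> A"
    and "conjoint S M R y = Range1"
    and "D x y"
  shows "\<exists>Range2. conjoint S M R x = Range2 \<and> range_not_worse Range2 Range1"
proof -
  have M: "M \<ge> 1" using assms(1) by simp
  have SD: "\<And>u v w. u \<in> A \<Longrightarrow> v \<in> A \<Longrightarrow> w \<in> A \<Longrightarrow> S u v \<Longrightarrow> D v w \<Longrightarrow> S u w"
    and DS: "\<And>u v w. u \<in> A \<Longrightarrow> v \<in> A \<Longrightarrow> w \<in> A \<Longrightarrow> D u v \<Longrightarrow> S v w \<Longrightarrow> S u w"
    using assms(2) unfolding condition1_def by blast+
  have R: "R k \<subseteq> A" if "k \<in> {1..M}" for k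
    using assms(3) that unfolding condition2_def by blast
  \<comment> \<open>The witness \<open>z\<close> for \<open>y\<close> also serves \<open>x\<close>:
    \<open>D x y\<close> and \<open>S y z\<close> compose to \<open>S x z\<close>, as
    \<open>z\<close> lies in \<open>A\<close>.\<close>
  have "act_S_set S R x k" if "k \<in> {1..M}" "act_S_set S R y k" for k
    using that R[OF that(1)] DS[OF assms(4,5) _ assms(7)] unfolding act_S_set_def by blast
  then have "fst (descending S M R y) \<le> fst (descending S M R x)"
    by (rule fst_descending_mono[OF M])
  \<comment> \<open>Here \<open>S w x\<close> and \<open>D x y\<close> compose to
    \<open>S w y\<close>.\<close>
  moreover have "set_S_act S M R k y" if "k \<in> {1..M}" "set_S_act S M R k x" for k
    using that R[OF that(1)] SD[OF _ assms(4,5) _ assms(7)] unfolding set_S_act_def by blast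
  then have "snd (ascending S M R y) \<le> snd (ascending S M R x)"
    by (rule snd_ascending_mono[OF M])
  \<comment> \<open>\<open>min\<close> and \<open>max\<close> are monotone in both arguments, so it
    does not matter whether the two limits swap order between \<open>y\<close> and
    \<open>x\<close>.\<close>
  ultimately have "range_not_worse (conjoint S M R x) (conjoint S M R y)"
    unfolding range_not_worse_def conjoint_limits[OF M] fst_conv snd_conv
    by (intro conjI min.mono max.mono)
  then show ?thesis using assms(6) by simp
qed

end
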